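(* Let $\mathbb{F}$ be a field and $d\ge0$ an integer. Let $\Psi=(\mathcal{C};\{x_i\}_{i=0}^d;\{e_i\}_{i=0}^d)$ be a character system over $\mathbb{F}$ with diameter $d$. Then the eigenmatrix $P$ of $\Psi$ is almost orthogonal (AO).
   Context: All algebras are associative, unital, over $\mathbb{F}$. Matrices in $\mathrm{Mat}_{d+1}(\mathbb{F})$ have rows and columns indexed by $0,1,\ldots,d$. A character algebra over $\mathbb{F}$ with diameter $d$ is a sequence $(\mathcal{C};\{x_i\}_{i=0}^d)$ where $\mathcal{C}$ is a commutative $\mathbb{F}$-algebra and $x_i\in\mathcal{C}$ satisfy: (i) $x_0=1$; (ii) $\{x_i\}_{i=0}^d$ is a basis of $\mathcal{C}$; (iii) writing $x_ix_j=\sum_{h=0}^d p^h_{ij}x_h$, there are nonzero scalars $\{k_i\}_{i=0}^d$ with $p^0_{ij}=\delta_{i,j}k_i$ for $0\le i,j\le d$; (iv) there is an algebra homomorphism $\varphi:\mathcal{C}\to\mathbb{F}$ with $\varphi(x_i)=k_i$ for $0\le i\le d$. It is semisimple if $\mathcal{C}$ has a basis $\{e_i\}_{i=0}^d$ with $e_ie_j=\delta_{i,j}e_i$ and $1=\sum_{i=0}^d e_i$; these $e_i$ (unique up to permutation) are the primitive idempotents. Exactly one primitive idempotent is not sent to $0$ by $\varphi$; it is called trivial. A character system over $\mathbb{F}$ with diameter $d$ is a sequence $\Psi=(\mathcal{C};\{x_i\}_{i=0}^d;\{e_i\}_{i=0}^d)$ where $(\mathcal{C};\{x_i\}_{i=0}^d)$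 is a semisimple character algebra over $\mathbb{F}$ and $\{e_i\}_{i=0}^d$ is an ordering of the primitive idempotents with $e_0$ trivial. The eigenmatrix $P$ of $\Psi$ is the transition matrix from $\{e_i\}$ to $\{x_i\}$: $x_j=\sum_{i=0}^dP_{i,j}e_i$ for $0\le j\le d$. Matrices $S,T\in\mathrm{Mat}_{d+1}(\mathbb{F})$ are diagonally equivalent if $T=HSK$ for some invertible diagonal matrices $H,K\in\mathrm{Mat}_{d+1}(\mathbb{F})$. A matrix $R$ is almost orthogonal (AO) if $R$ is invertible and $R^{\sf t}$ (transpose) is diagonally equivalent to $R^{-1}$. *)

theory Defs
  imports "Jordan_Normal_Form.Matrix"
begin

text \<open>
  The algebra is the whole type \<^typ>\<open>'c\<close>. Class \<^class>\<open>comm_ring_1\<close> excludes only the zero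
  algebra, which has no basis with \<open>d + 1\<close> elements. Families \<open>x\<^sub>0, \<dots>, x\<^sub>d\<close> are functions on
  \<^typ>\<open>nat\<close> of which only the values at arguments \<open>\<le> d\<close> matter.
\<close>

locale commutative_algebra = vector_space scale
  for scale :: "'f::field \<Rightarrow> 'c::comm_ring_1 \<Rightarrow> 'c" (infixr "*s" 75) +
  assumes scale_mult_left: "(a *s u) * v = a *s (u * v)"
begin

definition is_basis :: "nat \<Rightarrow> (nat \<Rightarrow> 'c) \<Rightarrow> bool" where
  "is_basis d b \<longleftrightarrow> inj_on b {..d} \<and> independent (b ` {..d}) \<and> span (b ` {..d}) = UNIV"

definition coord :: "nat \<Rightarrow> (nat \<Rightarrow> 'c) \<Rightarrow> 'c \<Rightarrow> nat \<Rightarrow> 'f" where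
  "coord d b v i = representation (b ` {..d}) v (b i)"

lemma sum_coord:
  assumes "is_basis d b"
  shows "(\<Sum>i\<le>d. coord d b v i *s b i) = v"
proof -
  have "(\<Sum>i\<le>d. coord d b v i *s b i) = (\<Sum>w\<in>b ` {..d}. representation (b ` {..d}) v w *s w)"
    using assms by (simp add: is_basis_def coord_def sum.reindex)
  also have "\<dots> = v"
    using assms by (intro sum_representation_eq) (auto simp: is_basis_def)
  finally show ?thesis .
qed

definition algebra_hom :: "('c \<Rightarrow> 'f) \<Rightarrow> bool" where
  "algebra_hom \<phi> \<longleftrightarrow> Vector_Spaces.linear scale (*) \<phi> \<and> \<phi> 1 = 1 \<and> (\<forall>u v. \<phi> (u * v) = \<phi> u * \<phi> v)"

text \<open>The scalar \<open>p\<^sup>h\<^sub>i\<^sub>j\<close> is \<open>structure_const d x h i j\<close>.\<close>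

definition structure_const :: "nat \<Rightarrow> (nat \<Rightarrow> 'c) \<Rightarrow> nat \<Rightarrow> nat \<Rightarrow> nat \<Rightarrow> 'f" where
  "structure_const d x h i j = coord d x (x i * x j) h"

definition valencies_and_hom :: "nat \<Rightarrow> (nat \<Rightarrow> 'c) \<Rightarrow> (nat \<Rightarrow> 'f) \<Rightarrow> ('c \<Rightarrow> 'f) \<Rightarrow> bool" where
  "valencies_and_hom d x k \<phi> \<longleftrightarrow>
     (\<forall>i\<le>d. k i \<noteq> 0) \<and>
     (\<forall>i\<le>d. \<forall>j\<le>d. structure_const d x 0 i j = (if i = j then k i else 0)) \<and>
     algebra_hom \<phi> \<and> (\<forall>i\<le>d. \<phi> (x i) = k i)"

definition character_algebra :: "nat \<Rightarrow> (nat \<Rightarrow> 'c) \<Rightarrow> bool" where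
  "character_algebra d x \<longleftrightarrow> x 0 = 1 \<and> is_basis d x \<and> (\<exists>k \<phi>. valencies_and_hom d x k \<phi>)"

definition primitive_idempotents :: "nat \<Rightarrow> (nat \<Rightarrow> 'c) \<Rightarrow> bool" where
  "primitive_idempotents d e \<longleftrightarrow>
     is_basis d e \<and>
     (\<forall>i\<le>d. \<forall>j\<le>d. e i * e j = (if i = j then e i else 0)) \<and>
     1 = (\<Sum>i\<le>d. e i)"

definition semisimple_character_algebra :: "nat \<Rightarrow> (nat \<Rightarrow> 'c) \<Rightarrow> bool" where
  "semisimple_character_algebra d x \<longleftrightarrow>
     character_algebra d x \<and> (\<exists>e. primitive_idempotents d e)"

text \<open>
  If \<open>x\<close> is a basis, then \<open>k\<close> (on arguments \<open>\<le> d\<close>) and \<open>\<phi>\<close> are determined by \<open>x\<close>, so the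
  quantifier in the next definition ranges over a single homomorphism.
\<close>

definition trivial_idempotent :: "nat \<Rightarrow> (nat \<Rightarrow> 'c) \<Rightarrow> 'c \<Rightarrow> bool" where
  "trivial_idempotent d x u \<longleftrightarrow> (\<exists>k \<phi>. valencies_and_hom d x k \<phi> \<and> \<phi> u \<noteq> 0)"

definition character_system :: "nat \<Rightarrow> (nat \<Rightarrow> 'c) \<Rightarrow> (nat \<Rightarrow> 'c) \<Rightarrow> bool" where
  "character_system d x e \<longleftrightarrow>
     semisimple_character_algebra d x \<and> primitive_idempotents d e \<and> trivial_idempotent d x (e 0)"

definition eigenmatrix :: "nat \<Rightarrow> (nat \<Rightarrow> 'c) \<Rightarrow> (nat \<Rightarrow> 'c) \<Rightarrow> 'f mat" where
  "eigenmatrix d x e = mat (d + 1) (d + 1) (\<lambda>(i, j). coord d e (x j) i)"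

lemma eigenmatrix_transition:
  assumes "is_basis d e" and "j \<le> d"
  shows "x j = (\<Sum>i\<le>d. eigenmatrix d x e $$ (i, j) *s e i)"
  using sum_coord[OF assms(1), of "x j"] assms(2) by (simp add: eigenmatrix_def)

end

definition diagonally_equivalent :: "nat \<Rightarrow> 'f::field mat \<Rightarrow> 'f mat \<Rightarrow> bool" where
  "diagonally_equivalent n S T \<longleftrightarrow>
     S \<in> carrier_mat n n \<and> T \<in> carrier_mat n n \<and>
     (\<exists>H \<in> carrier_mat n n. \<exists>K \<in> carrier_mat n n.
        diagonal_mat H \<and> invertible_mat H \<and> diagonal_mat K \<and> invertible_mat K \<and>
        T = H * S * K)"

text \<open>
  The matrix \<open>R'\<close> below is the inverse of \<open>R\<close>; its existence is the invertibility of \<open>R\<close>.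
\<close>

definition almost_orthogonal :: "nat \<Rightarrow> 'f::field mat \<Rightarrow> bool" where
  "almost_orthogonal n R \<longleftrightarrow>
     R \<in> carrier_mat n n \<and>
     (\<exists>R' \<in> carrier_mat n n. inverts_mat R R' \<and> inverts_mat R' R \<and>
        diagonally_equivalent n (transpose_mat R) R')"

end

theory Submission
  imports Defs "Jordan_Normal_Form.Determinant"
begin

text \<open>
  Let \<open>\<tau>\<close> be the functional that reads off the \<open>x\<^sub>0\<close>-coordinate, so that
  \<open>\<tau>(x\<^sub>i x\<^sub>j) = \<delta>\<^sub>i\<^sub>j k\<^sub>i\<close>. Expanding the products in the orthogonal idempotents gives
  \<open>P\<^sup>t M P = K\<close> with \<open>M = diag(\<tau>(e\<^sub>i))\<close> and \<open>K = diag(k\<^sub>i)\<close>. Since \<open>K\<close> is invertible,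
  \<open>K\<^sup>-\<^sup>1 P\<^sup>t M\<close> is a left inverse of \<open>P\<close>, hence the inverse of \<open>P\<close>, and so \<open>M\<close> is invertible.
\<close>

text \<open>Over a field, a one-sided inverse of a square matrix is two-sided, so a single product
  settles both factors.\<close>

lemma mult_eq_one_imp_invertible_mat:
  fixes A B :: "'f::field mat"
  assumes "A \<in> carrier_mat n n" "B \<in> carrier_mat n n" "A * B = 1\<^sub>m n"
  shows "invertible_mat A" "invertible_mat B"
proof -
  have "B * A = 1\<^sub>m n"
    using assms by (rule mat_mult_left_right_inverse)
  then have "inverts_mat A B" "inverts_mat B A"
    using assms by (auto simp: inverts_mat_def)
  then show "invertible_mat A" "invertible_mat B"
    using assms unfolding invertible_mat_def by auto
qed

lemma almost_orthogonal_if_diagonalizes: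
  fixes P :: "'f::field mat"
  assumes P: "P \<in> carrier_mat n n"
    and k: "\<And>i. i < n \<Longrightarrow> k i \<noteq> 0"
    and eq: "transpose_mat P * mat_diag n m * P = mat_diag n k"
  shows "almost_orthogonal n P"
proof -
  define H where "H = mat_diag n (\<lambda>i. inverse (k i))"
  define M where "M = mat_diag n m"
  \<comment> \<open>The candidate for the inverse of \<open>P\<close>, already in the shape that
    diagonal equivalence with \<open>transpose_mat P\<close> demands.\<close>
  define R where "R = H * transpose_mat P * M"
  have carrier [simp]: "H \<in> carrier_mat n n" "M \<in> carrier_mat n n" "R \<in> carrier_mat n n"
    "transpose_mat P \<in> carrier_mat n n"
    using P by (simp_all add: H_def M_def R_def mult_carrier_mat[of _ n n _ n])
  have H_K: "H * mat_diag n k = 1\<^sub>m n"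
    unfolding H_def mat_diag_diag by (rule eq_matI) (auto simp: mat_diag_def k)
  have "R * P = H * (transpose_mat P * M * P)"
    using P by (simp add: R_def assoc_mult_mat[of _ n n _ n _ n] mult_carrier_mat[of _ n n _ n])
  then have R_P: "R * P = 1\<^sub>m n"
    using eq H_K by (simp add: M_def)
  then have P_R: "P * R = 1\<^sub>m n"
    by (rule mat_mult_left_right_inverse[rotated 2]) (use P in simp_all)
  \<comment> \<open>Regrouping \<open>P * R\<close> makes \<open>M\<close> the right factor of a
    product equal to the identity; this shows that no diagonal entry \<open>m i\<close> with
    \<open>i < n\<close> vanishes.\<close>
  have "(P * H * transpose_mat P) * M = P * R"
    using P by (simp add: R_def assoc_mult_mat[of _ n n _ n _ n] mult_carrier_mat[of _ n n _ n])
  then have "invertible_mat M"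
    using P P_R
    by (intro mult_eq_one_imp_invertible_mat(2)[of "P * H * transpose_mat P" n])
      (simp_all add: mult_carrier_mat[of _ n n _ n])
  moreover have "invertible_mat H"
    by (rule mult_eq_one_imp_invertible_mat(1)[OF _ _ H_K]) (auto simp: mat_diag_def)
  moreover have "diagonal_mat H" "diagonal_mat M"
    by (auto simp: diagonal_mat_def H_def M_def mat_diag_def)
  ultimately have "diagonally_equivalent n (transpose_mat P) R"
    unfolding diagonally_equivalent_def using carrier R_def by blast
  with P P_R R_P show ?thesis
    unfolding almost_orthogonal_def inverts_mat_def
    by (intro conjI bexI[of _ R]) (simp_all add: carrier_matD[of _ n n])
qed

context commutative_algebra
begin

lemma coord_sum_scale:
  assumes "is_basis d b" "i \<le> d" "finite A"
  shows "coord d b (\<Sum>h\<in>A. c h *s v h) i = (\<Sum>h\<in>A. c h * coord d b (v h) i)"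
proof -
  have "independent (b ` {..d})" "span (b ` {..d}) = UNIV"
    using assms by (auto simp: is_basis_def)
  then show ?thesis
    by (simp add: coord_def representation_sum representation_scale)
qed

lemma scale_mult_scale: "(a *s u) * (b *s v) = (a * b) *s (u * v)"
  by (metis scale_mult_left scale_scale mult.commute)

text \<open>Orthogonality kills the cross terms, so multiplication is entrywise in coordinates with
  respect to \<open>e\<close>.\<close>

lemma mult_in_primitive_idempotents:
  assumes "primitive_idempotents d e"
  shows "(\<Sum>h\<le>d. a h *s e h) * (\<Sum>h\<le>d. b h *s e h) = (\<Sum>h\<le>d. (a h * b h) *s e h)"
proof -
  have "(a h *s e h) * (b l *s e l) = (if h = l then (a h * b h) *s e h else 0)"
    if "h \<le> d" "l \<le> d" for h l
    using assms that by (simp add: primitive_idempotents_def scale_mult_scale)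
  then have "(\<Sum>h\<le>d. a h *s e h) * (\<Sum>h\<le>d. b h *s e h)
      = (\<Sum>h\<le>d. \<Sum>l\<le>d. if h = l then (a h * b h) *s e h else 0)"
    by (simp add: sum_product)
  then show ?thesis
    by simp
qed

lemma eigenmatrix_carrier: "eigenmatrix d x e \<in> carrier_mat (d + 1) (d + 1)"
  by (simp add: eigenmatrix_def)

text \<open>Columns \<open>i\<close> and \<open>j\<close> of the eigenmatrix hold the
  \<open>e\<close>-coordinates of \<open>x i\<close> and \<open>x j\<close>. Their entrywise product
  gives \<open>x i * x j\<close>, and reading off the \<open>x l\<close>-coordinate is
  linear.\<close>

lemma structure_const_eigenmatrix:
  assumes "is_basis d x" "primitive_idempotents d e" "i \<le> d" "j \<le> d" "l \<le> d"
  shows "structure_const d x l i j =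
    (\<Sum>h\<le>d. eigenmatrix d x e $$ (h, i) * eigenmatrix d x e $$ (h, j) * coord d x (e h) l)"
proof -
  let ?P = "\<lambda>h i. eigenmatrix d x e $$ (h, i)"
  have "is_basis d e"
    using assms(2) by (simp add: primitive_idempotents_def)
  then have "x i = (\<Sum>h\<le>d. ?P h i *s e h)" "x j = (\<Sum>h\<le>d. ?P h j *s e h)"
    using assms(3,4) by (blast intro: eigenmatrix_transition)+
  then have "x i * x j = (\<Sum>h\<le>d. (?P h i * ?P h j) *s e h)"
    using mult_in_primitive_idempotents[OF assms(2)] by simp
  then show ?thesis
    using assms by (simp add: structure_const_def coord_sum_scale)
qed

text \<open>The case \<open>l = 0\<close> of the preceding formula, collected over all
  \<open>i\<close> and \<open>j\<close> into one matrix identity.\<close>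

lemma eigenmatrix_diagonalizes:
  assumes "is_basis d x" "primitive_idempotents d e"
    and k: "\<And>i j. i \<le> d \<Longrightarrow> j \<le> d \<Longrightarrow> structure_const d x 0 i j = (if i = j then k i else 0)"
  shows "transpose_mat (eigenmatrix d x e) * mat_diag (d + 1) (\<lambda>h. coord d x (e h) 0)
      * eigenmatrix d x e = mat_diag (d + 1) k"
    (is "transpose_mat ?P * ?M * ?P = _")
proof (rule eq_matI)
  fix i j
  assume "i < dim_row (mat_diag (d + 1) k)" "j < dim_col (mat_diag (d + 1) k)"
  then have ij: "i \<le> d" "j \<le> d"
    by (auto simp: mat_diag_def)
  \<comment> \<open>Right multiplication by \<open>?M\<close> scales column \<open>h\<close> of
    \<open>transpose_mat ?P\<close> by the \<open>h\<close>-th diagonal entry.\<close>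
  have "(transpose_mat ?P * ?M * ?P) $$ (i, j)
      = (\<Sum>h\<le>d. ?P $$ (h, i) * coord d x (e h) 0 * ?P $$ (h, j))"
    using eigenmatrix_carrier[of d x e] ij
    by (subst mat_diag_mult_right[of _ "d + 1"])
      (auto simp: scalar_prod_def atLeast0LessThan lessThan_Suc_atMost intro!: sum.cong)
  also have "\<dots> = structure_const d x 0 i j"
    using assms ij by (simp add: structure_const_eigenmatrix mult_ac)
  finally show "(transpose_mat ?P * ?M * ?P) $$ (i, j) = mat_diag (d + 1) k $$ (i, j)"
    using ij k by (simp add: mat_diag_def)
qed (use eigenmatrix_carrier[of d x e] in \<open>auto simp: mat_diag_def\<close>)

lemma almost_orthogonal_eigenmatrix:
  assumes "character_system d x e"
  shows "almost_orthogonal (d + 1) (eigenmatrix d x e)"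
proof -
  \<comment> \<open>The valencies \<open>k i\<close> form the diagonal on the right-hand side; being
    nonzero, they make that matrix invertible.\<close>
  obtain k where k: "\<And>i. i \<le> d \<Longrightarrow> k i \<noteq> 0"
      "\<And>i j. i \<le> d \<Longrightarrow> j \<le> d \<Longrightarrow> structure_const d x 0 i j = (if i = j then k i else 0)"
    and "is_basis d x" "primitive_idempotents d e"
    using assms unfolding character_system_def semisimple_character_algebra_def
      character_algebra_def valencies_and_hom_def by blast
  then show ?thesis
    by (intro almost_orthogonal_if_diagonalizes[OF eigenmatrix_carrier _ eigenmatrix_diagonalizes])
      auto
qed

end

theorem proposition10p12:
  fixes scale :: "'f::field \<Rightarrow> 'c::comm_ring_1 \<Rightarrow> 'c"
    and d :: nat
    and x e :: "nat \<Rightarrow> 'c"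
  assumes "commutative_algebra scale"
    and "commutative_algebra.character_system scale d x e"
  shows "almost_orthogonal (d + 1) (commutative_algebra.eigenmatrix scale d x e)"
  using assms by (rule commutative_algebra.almost_orthogonal_eigenmatrix)

end
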